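(* For the boost converter, which generally has $B_1=B_2$, let $$X(d)=\left(I-e^{A_1d}e^{A_2(T-d)}\right)^{-1}\left(e^{A_1d}\int_0^{T-d}e^{A_2\sigma}d\sigma+\int_0^de^{A_1\sigma}d\sigma\right),$$ $$\Lambda(d)=I+\left(A_1-\left(I-e^{-A_2(T-d)}e^{-A_1d}\right)^{-1}(A_1-A_2)\right)X(d).$$ Then the saddle-node bifurcation boundary condition $$C(A_1 x^0(d) + B_1 u) - C\left(I - e^{-A_2(T-d)} e^{-A_1 d}\right)^{-1}\left((A_1 - A_2) x^0(d) + (B_1 - B_2) u\right) = \dot{h}(d)$$ becomes $$C\Lambda(d)B_1u=\dot h(d),$$ or, in terms of $v_s$, $$v_s=\frac{\dot h(d)-C\Lambda(d)B_{12}v_r}{C\Lambda(d)B_{11}}.$$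
   Context: Model. $A_1,A_2\in\mathbf R^{N\times N}$, $B_1=[B_{11},B_{12}]$, $B_2=[B_{21},B_{22}]\in\mathbf R^{N\times 2}$ (written by columns), $C\in\mathbf R^{1\times N}$, $D\in\mathbf R^{1\times 2}$ are constant matrices and $u=(v_s,v_r)'$ consists of the source voltage $v_s$ and the control signal $v_r$. Within a clock period $T$, the dynamics is switched between two stages, $S_1$: $\dot x=A_1x+B_1u$, followed by $S_2$: $\dot x=A_2x+B_2u$. Switching occurs when the ramp signal $h(t)$ intersects $y:=Cx+Du$. Steady state. $x^0(t)$ is a $T$-periodic solution, in stage $S_1$ from $0$ to $d$ and in stage $S_2$ from $d$ to $T$, so that $x^0(d)=e^{A_1d}x^0(0)+\int_0^d e^{A_1\sigma}d\sigma\,B_1u$, $x^0(0)=e^{A_2(T-d)}x^0(d)+\int_0^{T-d}e^{A_2\sigma}d\sigma\,B_2u$. When $B_1=B_2$ this gives $x^0(d)=X(d)B_1u$. $\dot h(d)$ is the ramp slope at $t=d$. The saddle-node bifurcation boundary condition is the condition on converter parameters under which saddle-node bifurcation of the $T$-periodic solution occurs; saddle-node bifurcation occurs when one eigenvalue of the Jacobian matrix of the linearized sampled-data (period-to-period) dynamics is $1$. *)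

theory Defs
  imports "HOL-Analysis.Analysis"
begin

(* real^'n^'n is not a normed algebra in the library (its product * is componentwise),
   so exp is not available at this type. *)
definition mexp :: "real^'n^'n \<Rightarrow> real^'n^'n" where
  "mexp A = (\<Sum>k. (1 / fact k) *\<^sub>R (((**) A ^^ k) (mat 1)))"

definition mexp_integral :: "real^'n^'n \<Rightarrow> real \<Rightarrow> real^'n^'n" where
  "mexp_integral A t = integral {0..t} (\<lambda>\<sigma>. mexp (\<sigma> *\<^sub>R A))"

definition has_eigenvalue :: "real^'n^'n \<Rightarrow> real \<Rightarrow> bool" where
  "has_eigenvalue M \<mu> \<longleftrightarrow> (\<exists>v. v \<noteq> 0 \<and> M *v v = \<mu> *\<^sub>R v)"

definition stage_solution ::
  "real^'n^'n \<Rightarrow> real^2^'n \<Rightarrow> real^2 \<Rightarrow> (real \<Rightarrow> real^'n) \<Rightarrow> real set \<Rightarrow> bool" where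
  "stage_solution A B u x I \<longleftrightarrow>
     (\<forall>t\<in>I. (x has_vector_derivative (A *v x t + B *v u)) (at t within I))"

definition converter_output :: "real^'n^1 \<Rightarrow> real^2^1 \<Rightarrow> real^2 \<Rightarrow> real^'n \<Rightarrow> real" where
  "converter_output C D u z = (C *v z + D *v u) $ 1"

definition periodic_solution ::
  "real^'n^'n \<Rightarrow> real^2^'n \<Rightarrow> real^'n^'n \<Rightarrow> real^2^'n \<Rightarrow> real^'n^1 \<Rightarrow> real^2^1 \<Rightarrow> real^2 \<Rightarrow>
   (real \<Rightarrow> real) \<Rightarrow> real \<Rightarrow> real \<Rightarrow> (real \<Rightarrow> real^'n) \<Rightarrow> bool" where
  "periodic_solution A1 B1 A2 B2 C D u h T d x \<longleftrightarrow>
     (\<forall>t. x (t + T) = x t) \<and>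
     stage_solution A1 B1 u x {0..d} \<and>
     stage_solution A2 B2 u x {d..T} \<and>
     converter_output C D u (x d) = h d"

definition stage_flow ::
  "real^'n^'n \<Rightarrow> real^2^'n \<Rightarrow> real^2 \<Rightarrow> real \<Rightarrow> real^'n \<Rightarrow> real^'n" where
  "stage_flow A B u t z = mexp (t *\<^sub>R A) *v z + (mexp_integral A t ** B) *v u"

(* \<delta> z is the instant at which the cycle started in state z switches to the second stage,
   for z near the steady state z0, whose cycle switches at d. *)
definition local_switching_instant ::
  "real^'n^'n \<Rightarrow> real^2^'n \<Rightarrow> real^'n^1 \<Rightarrow> real^2^1 \<Rightarrow> real^2 \<Rightarrow> (real \<Rightarrow> real) \<Rightarrow> real \<Rightarrow>
   real^'n \<Rightarrow> (real^'n \<Rightarrow> real) \<Rightarrow> bool" where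
  "local_switching_instant A1 B1 C D u h d z0 \<delta> \<longleftrightarrow>
     \<delta> z0 = d \<and> isCont \<delta> z0 \<and>
     (\<forall>\<^sub>F z in nhds z0. converter_output C D u (stage_flow A1 B1 u (\<delta> z) z) = h (\<delta> z))"

definition sampled_data_map ::
  "real^'n^'n \<Rightarrow> real^2^'n \<Rightarrow> real^'n^'n \<Rightarrow> real^2^'n \<Rightarrow> real^2 \<Rightarrow> real \<Rightarrow>
   (real^'n \<Rightarrow> real) \<Rightarrow> real^'n \<Rightarrow> real^'n" where
  "sampled_data_map A1 B1 A2 B2 u T \<delta> z =
     stage_flow A2 B2 u (T - \<delta> z) (stage_flow A1 B1 u (\<delta> z) z)"

definition sampled_data_jacobian ::
  "real^'n^'n \<Rightarrow> real^2^'n \<Rightarrow> real^'n^'n \<Rightarrow> real^2^'n \<Rightarrow> real^'n^1 \<Rightarrow> real^2^1 \<Rightarrow> real^2 \<Rightarrow>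
   (real \<Rightarrow> real) \<Rightarrow> real \<Rightarrow> real \<Rightarrow> real^'n \<Rightarrow> real^'n^'n \<Rightarrow> bool" where
  "sampled_data_jacobian A1 B1 A2 B2 C D u h T d z0 J \<longleftrightarrow>
     (\<exists>\<delta>. local_switching_instant A1 B1 C D u h d z0 \<delta> \<and>
          (sampled_data_map A1 B1 A2 B2 u T \<delta> has_derivative (\<lambda>v. J *v v)) (at z0))"

definition saddle_node_bifurcation ::
  "real^'n^'n \<Rightarrow> real^2^'n \<Rightarrow> real^'n^'n \<Rightarrow> real^2^'n \<Rightarrow> real^'n^1 \<Rightarrow> real^2^1 \<Rightarrow> real^2 \<Rightarrow>
   (real \<Rightarrow> real) \<Rightarrow> real \<Rightarrow> real \<Rightarrow> (real \<Rightarrow> real^'n) \<Rightarrow> bool" where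
  "saddle_node_bifurcation A1 B1 A2 B2 C D u h T d x \<longleftrightarrow>
     (\<exists>J. sampled_data_jacobian A1 B1 A2 B2 C D u h T d (x 0) J \<and> has_eigenvalue J 1)"

definition saddle_node_boundary ::
  "real^'n^'n \<Rightarrow> real^2^'n \<Rightarrow> real^'n^'n \<Rightarrow> real^2^'n \<Rightarrow> real^'n^1 \<Rightarrow> real^2 \<Rightarrow>
   (real \<Rightarrow> real) \<Rightarrow> real \<Rightarrow> real \<Rightarrow> (real \<Rightarrow> real^'n) \<Rightarrow> bool" where
  "saddle_node_boundary A1 B1 A2 B2 C u h T d x \<longleftrightarrow>
     (C *v (A1 *v x d + B1 *v u)) $ 1
     - (C *v (matrix_inv (mat 1 - mexp (- ((T - d) *\<^sub>R A2)) ** mexp (- (d *\<^sub>R A1)))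
              *v ((A1 - A2) *v x d + (B1 - B2) *v u))) $ 1
     = deriv h d"

definition X_mat :: "real^'n^'n \<Rightarrow> real^'n^'n \<Rightarrow> real \<Rightarrow> real \<Rightarrow> real^'n^'n" where
  "X_mat A1 A2 T d =
     matrix_inv (mat 1 - mexp (d *\<^sub>R A1) ** mexp ((T - d) *\<^sub>R A2))
     ** (mexp (d *\<^sub>R A1) ** mexp_integral A2 (T - d) + mexp_integral A1 d)"

definition Lambda_mat :: "real^'n^'n \<Rightarrow> real^'n^'n \<Rightarrow> real \<Rightarrow> real \<Rightarrow> real^'n^'n" where
  "Lambda_mat A1 A2 T d =
     mat 1 + (A1 - matrix_inv (mat 1 - mexp (- ((T - d) *\<^sub>R A2)) ** mexp (- (d *\<^sub>R A1)))
                   ** (A1 - A2)) ** X_mat A1 A2 T d"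

end

theory Submission
  imports Defs
begin

text \<open>Differentiating the switching condition in the initial state \<^term>\<open>z\<close> shows that the
  Jacobian of the period map is \<^term>\<open>\<lambda>v. E2 *v (E1 *v v - ((C *v (E1 *v v)) $ 1 / c) *\<^sub>R w)\<close>, where
  \<^term>\<open>E1\<close> and \<^term>\<open>E2\<close> are the exponentials of the two stages, \<^term>\<open>w\<close> is the jump of the velocity at
  the switching instant and \<^term>\<open>c\<close> is the difference of the slopes of output and ramp there. This is
  a rank-one perturbation of \<^term>\<open>E2 ** E1\<close>, so it has the eigenvalue 1 iff a scalar equation holds,
  and that equation is the boundary condition. As the ramp is only differentiable, the switching
  instant is obtained from the intermediate value theorem.\<close>

section \<open>The matrix exponential as an entrywise power series\<close>

lemma bounded_bilinear_matrix_mult: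
  "bounded_bilinear ((**) :: real^'n^'m \<Rightarrow> real^'p^'n \<Rightarrow> real^'p^'m)"
  unfolding bilinear_conv_bounded_bilinear [symmetric] bilinear_def
  by (auto intro!: linearI simp: matrix_matrix_mult_def vec_eq_iff algebra_simps sum.distrib sum_distrib_left)

lemma bounded_bilinear_matrix_vector_mult:
  "bounded_bilinear ((*v) :: real^'n^'m \<Rightarrow> real^'n \<Rightarrow> real^'m)"
  unfolding bilinear_conv_bounded_bilinear [symmetric] bilinear_def
  by (auto intro!: linearI simp: matrix_vector_mult_def vec_eq_iff algebra_simps sum.distrib sum_distrib_left)

lemma matrix_scaleR_mult_left: "(c *\<^sub>R A) ** B = c *\<^sub>R (A ** (B :: real^'p^'n))"
  by (rule bounded_bilinear.scaleR_left [OF bounded_bilinear_matrix_mult])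

lemma matrix_scaleR_mult_right: "(A :: real^'n^'m) ** (c *\<^sub>R B) = c *\<^sub>R (A ** B)"
  by (rule bounded_bilinear.scaleR_right [OF bounded_bilinear_matrix_mult])

abbreviation mpow :: "real^'n^'n \<Rightarrow> nat \<Rightarrow> real^'n^'n" where
  "mpow A k \<equiv> ((**) A ^^ k) (mat 1)"

lemma mpow_scaleR: "mpow (t *\<^sub>R A) k = t ^ k *\<^sub>R mpow A k"
  by (induction k) (simp_all add: matrix_scaleR_mult_left matrix_scaleR_mult_right)

lemma mpow_commutes: "A ** mpow A k = mpow A k ** A"
proof (induction k)
  case (Suc k)
  then show ?case
    by simp (metis matrix_mul_assoc)
qed simp

text \<open>Each further factor \<open>A\<close> turns an entry into a sum of
  \<open>CARD('n)\<close> products, hence the growth rate \<open>CARD('n) * b\<close>. This lets the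
  scalar exponential series dominate every entry of the matrix series.\<close>

lemma mpow_entry_bound:
  fixes A :: "real^'n^'n"
  assumes "\<And>i j. \<bar>A $ i $ j\<bar> \<le> b"
  shows "\<bar>mpow A k $ i $ j\<bar> \<le> (real CARD('n) * b) ^ k"
proof (induction k arbitrary: i j)
  case 0
  show ?case by (simp add: mat_def)
next
  case (Suc k)
  have "0 \<le> b" using assms [of undefined undefined] by linarith
  have "\<bar>mpow A (Suc k) $ i $ j\<bar> \<le> (\<Sum>l\<in>UNIV. \<bar>A $ i $ l * mpow A k $ l $ j\<bar>)"
    by (simp add: matrix_matrix_mult_def)
  also have "\<dots> \<le> (\<Sum>l\<in>(UNIV :: 'n set). b * (real CARD('n) * b) ^ k)"
    using assms Suc.IH \<open>0 \<le> b\<close> by (intro sum_mono) (auto simp: abs_mult intro!: mult_mono)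
  finally show ?case by (simp add: mult.assoc)
qed

lemma mpow_entry_summable:
  "summable (\<lambda>k. mpow (A :: real^'n^'n) k $ i $ j / fact k * t ^ k)"
proof -
  \<comment> \<open>The sum of the absolute values of all entries serves as a common bound for each
    of them.\<close>
  define b where "b = (\<Sum>i\<in>UNIV. \<Sum>j\<in>UNIV. \<bar>A $ i $ j\<bar>)"
  have b: "\<bar>A $ i $ j\<bar> \<le> b" for i j
    unfolding b_def
    by (rule order_trans [OF member_le_sum [where f = "\<lambda>j. \<bar>A $ i $ j\<bar>"]
          member_le_sum [where f = "\<lambda>i. \<Sum>j\<in>UNIV. \<bar>A $ i $ j\<bar>"]]) (auto intro: sum_nonneg)
  show ?thesis
  proof (rule summable_comparison_test')
    show "summable (\<lambda>k. inverse (fact k) * (real CARD('n) * b * \<bar>t\<bar>) ^ k)"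
      by (rule summable_exp)
    show "norm (mpow A k $ i $ j / fact k * t ^ k) \<le> inverse (fact k) * (real CARD('n) * b * \<bar>t\<bar>) ^ k" for k
      using mult_right_mono [OF mpow_entry_bound [OF b, of k i j], of "\<bar>t\<bar> ^ k / fact k"]
      by (simp add: abs_mult power_abs power_mult_distrib field_simps)
  qed
qed

text \<open>\<open>mexp_def\<close> is a mere \<open>suminf\<close>; convergence, checked entry by
  entry, makes it usable. Keeping \<open>t\<close> outside the matrix powers exposes a power series
  in the time.\<close>

lemma mexp_sums: "(\<lambda>k. (t ^ k / fact k) *\<^sub>R mpow A k) sums mexp (t *\<^sub>R A)"
proof -
  have "(\<lambda>k. (t ^ k / fact k) *\<^sub>R mpow A k) sums (\<chi> i j. \<Sum>k. mpow A k $ i $ j / fact k * t ^ k)"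
    unfolding sums_def
  proof (intro vec_tendstoI, goal_cases)
    case (1 i j)
    show ?case
      using summable_LIMSEQ [OF mpow_entry_summable [of A i j t]]
      by (simp add: field_simps)
  qed
  then show ?thesis
    unfolding mexp_def mpow_scaleR by (simp add: sums_iff)
qed

lemma mexp_entry: "mexp (t *\<^sub>R A) $ i $ j = (\<Sum>k. mpow A k $ i $ j / fact k * t ^ k)"
  using sums_vec_nth [OF sums_vec_nth [OF mexp_sums [of t A], of i], of j]
  by (simp add: sums_iff field_simps)

text \<open>Multiplying the series by \<open>A\<close> from the left and from the right gives the
  same terms.\<close>

lemma mexp_commutes: "A ** mexp (t *\<^sub>R A) = mexp (t *\<^sub>R A) ** A"
proof -
  note bl = bounded_bilinear.bounded_linear_right [OF bounded_bilinear_matrix_mult]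
    and br = bounded_bilinear.bounded_linear_left [OF bounded_bilinear_matrix_mult]
  show ?thesis
    using bounded_linear.sums [OF bl [of A] mexp_sums [of t A]]
      bounded_linear.sums [OF br [of A] mexp_sums [of t A]]
    by (simp add: matrix_scaleR_mult_left matrix_scaleR_mult_right mpow_commutes sums_unique2)
qed

lemma matrix_mexp_entry: "(A ** mexp (t *\<^sub>R A)) $ i $ j = (\<Sum>k. mpow A (Suc k) $ i $ j / fact k * t ^ k)"
proof -
  note bl = bounded_bilinear.bounded_linear_right [OF bounded_bilinear_matrix_mult]
  show ?thesis
    using sums_vec_nth [OF sums_vec_nth [OF bounded_linear.sums [OF bl [of A] mexp_sums [of t A]], of i], of j]
    by (simp add: sums_iff matrix_scaleR_mult_right field_simps)
qed

lemma has_vector_derivative_matrix_entries: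
  fixes f :: "real \<Rightarrow> real^'n^'m"
  assumes "\<And>i j. ((\<lambda>t. f t $ i $ j) has_real_derivative f' $ i $ j) (at t within S)"
  shows "(f has_vector_derivative f') (at t within S)"
  unfolding has_vector_derivative_def
  by (subst has_derivative_componentwise_within)
    (use assms in \<open>auto simp: Basis_vec_def inner_axis has_field_derivative_def mult_commute_abs\<close>)

lemma mexp_has_vector_derivative:
  "((\<lambda>t. mexp (t *\<^sub>R A)) has_vector_derivative A ** mexp (t *\<^sub>R A)) (at t within S)"
proof (rule has_vector_derivative_matrix_entries)
  fix i j
  have "((\<lambda>t. \<Sum>k. mpow A k $ i $ j / fact k * t ^ k) has_real_derivative
      (\<Sum>k. diffs (\<lambda>k. mpow A k $ i $ j / fact k) k * t ^ k)) (at t)"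
    by (rule termdiffs_strong_converges_everywhere) (rule mpow_entry_summable)
  \<comment> \<open>Differentiation shifts the coefficients, and the new factor \<open>k + 1\<close>
    cancels against \<open>fact (k + 1)\<close>.\<close>
  moreover have "diffs (\<lambda>k. mpow A k $ i $ j / fact k) k = mpow A (Suc k) $ i $ j / fact k" for k
    by (simp add: diffs_def del: funpow.simps of_nat_Suc)
  ultimately show "((\<lambda>t. mexp (t *\<^sub>R A) $ i $ j) has_real_derivative
      (A ** mexp (t *\<^sub>R A)) $ i $ j) (at t within S)"
    by (simp add: mexp_entry matrix_mexp_entry has_field_derivative_at_within del: funpow.simps)
qed

lemma continuous_on_mexp: "continuous_on S (\<lambda>t. mexp (t *\<^sub>R A))"
  by (rule continuous_on_vector_derivative) (rule mexp_has_vector_derivative)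

lemma mexp_0 [simp]: "mexp 0 = mat 1"
proof -
  have "(\<lambda>k. (0 ^ k / fact k) *\<^sub>R mpow (0 :: real^'n^'n) k) sums mat 1"
    using sums_single [of 0 "\<lambda>k. mat 1 :: real^'n^'n"]
    by (rule sums_cong [THEN iffD1, rotated]) auto
  with mexp_sums [of 0 "0 :: real^'n^'n"] show ?thesis
    using sums_unique2 by auto
qed

text \<open>The product has derivative 0 in \<open>t\<close>, so it keeps its value at
  \<open>t = 0\<close>.\<close>

lemma mexp_minus_mult: "mexp (- (t *\<^sub>R A)) ** mexp (t *\<^sub>R A) = mat 1"
proof -
  have 1: "((\<lambda>t. mexp (t *\<^sub>R (- A))) has_vector_derivative (- A) ** mexp (t *\<^sub>R (- A))) (at t)" for t
    by (rule mexp_has_vector_derivative)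
  have "((\<lambda>t. mexp (t *\<^sub>R (- A)) ** mexp (t *\<^sub>R A)) has_vector_derivative
     (mexp (t *\<^sub>R (- A)) ** (A ** mexp (t *\<^sub>R A)) + ((- A) ** mexp (t *\<^sub>R (- A))) ** mexp (t *\<^sub>R A))) (at t)" for t
    by (rule bounded_bilinear.has_vector_derivative [OF bounded_bilinear_matrix_mult 1 mexp_has_vector_derivative])
  moreover have "mexp (t *\<^sub>R (- A)) ** (A ** mexp (t *\<^sub>R A)) + ((- A) ** mexp (t *\<^sub>R (- A))) ** mexp (t *\<^sub>R A) = 0" for t
    unfolding mexp_commutes [of "- A"] matrix_mul_assoc
    by (simp add: bounded_bilinear.minus_right [OF bounded_bilinear_matrix_mult]
        bounded_bilinear.minus_left [OF bounded_bilinear_matrix_mult])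
  ultimately have "((\<lambda>t. mexp (t *\<^sub>R (- A)) ** mexp (t *\<^sub>R A)) has_vector_derivative 0) (at t within UNIV)" for t
    by simp
  then obtain c where "\<And>t. mexp (t *\<^sub>R (- A)) ** mexp (t *\<^sub>R A) = c"
    using has_vector_derivative_zero_constant [of UNIV "\<lambda>t. mexp (t *\<^sub>R (- A)) ** mexp (t *\<^sub>R A)"]
    by auto
  from this [of t] this [of 0] show ?thesis by simp
qed

section \<open>The integral of the exponential and the flow of one stage\<close>

lemma mexp_integral_has_vector_derivative:
  assumes "t \<in> {0..b}"
  shows "(mexp_integral A has_vector_derivative mexp (t *\<^sub>R A)) (at t within {0..b})"
  using integral_has_vector_derivative [OF continuous_on_mexp assms]
  by (simp add: mexp_integral_def [abs_def])

text \<open>For negative \<open>t\<close> the integral runs over an empty interval and is 0, so at 0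
  there is only a derivative from the right.\<close>

lemma mexp_integral_has_vector_derivative_at:
  assumes "0 < t"
  shows "(mexp_integral A has_vector_derivative mexp (t *\<^sub>R A)) (at t)"
proof -
  have "(mexp_integral A has_vector_derivative mexp (t *\<^sub>R A)) (at t within {0..t + 1})"
    using assms by (intro mexp_integral_has_vector_derivative) auto
  then show ?thesis
    using assms by (simp add: at_within_Icc_at)
qed

lemma mexp_integral_0 [simp]: "mexp_integral A 0 = 0"
  by (simp add: mexp_integral_def)

lemma stage_flow_0 [simp]: "stage_flow A B u 0 z = z"
  by (simp add: stage_flow_def)

text \<open>Variation of constants: letting the state at time \<open>t\<close> flow for the
  remaining time \<open>b - t\<close> gives a result \<open>g t\<close> with derivative 0. Its
  values at \<open>a\<close> and \<open>b\<close> are the two sides.\<close>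

lemma stage_solution_eq_flow:
  assumes "stage_solution A B u x {a..b}" "a \<le> b"
  shows "x b = stage_flow A B u (b - a) (x a)"
proof -
  define g where "g t = stage_flow A B u (b - t) (x t)" for t
  have "(g has_vector_derivative 0) (at t within {a..b})" if t: "t \<in> {a..b}" for t
  proof -
    have r: "((\<lambda>t. b - t) has_vector_derivative -1) (at t within {a..b})"
      by (auto intro!: derivative_eq_intros)
    have E: "((\<lambda>t. mexp ((b - t) *\<^sub>R A)) has_vector_derivative - (A ** mexp ((b - t) *\<^sub>R A))) (at t within {a..b})"
      using vector_diff_chain_within [OF r mexp_has_vector_derivative [of A]] by (simp add: o_def)
    \<comment> \<open>The chain rule needs the image interval, because at 0 the derivative of
      \<open>mexp_integral\<close> is one-sided.\<close>
    have sub: "(\<lambda>t. b - t) ` {a..b} = {0..b - a}"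
      by (auto simp: image_iff intro!: bexI [of _ "b - _"])
    have I: "((\<lambda>t. mexp_integral A (b - t)) has_vector_derivative - mexp ((b - t) *\<^sub>R A)) (at t within {a..b})"
      using vector_diff_chain_within [OF r, of "mexp_integral A" "mexp ((b - t) *\<^sub>R A)"] t sub
        mexp_integral_has_vector_derivative [of "b - t" "b - a" A]
      by (simp add: o_def)
    have "((\<lambda>t. mexp ((b - t) *\<^sub>R A) *v x t) has_vector_derivative
        (mexp ((b - t) *\<^sub>R A) *v (A *v x t + B *v u) + (- (A ** mexp ((b - t) *\<^sub>R A))) *v x t)) (at t within {a..b})"
      using assms t unfolding stage_solution_def
      by (intro bounded_bilinear.has_vector_derivative [OF bounded_bilinear_matrix_vector_mult E]) auto
    moreover have "((\<lambda>t. mexp_integral A (b - t) *v (B *v u)) has_vector_derivative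
        (- mexp ((b - t) *\<^sub>R A)) *v (B *v u)) (at t within {a..b})"
      by (rule bounded_linear.has_vector_derivative
          [OF bounded_bilinear.bounded_linear_left [OF bounded_bilinear_matrix_vector_mult] I])
    ultimately have "(g has_vector_derivative
        (mexp ((b - t) *\<^sub>R A) *v (A *v x t + B *v u) + (- (A ** mexp ((b - t) *\<^sub>R A))) *v x t)
        + (- mexp ((b - t) *\<^sub>R A)) *v (B *v u)) (at t within {a..b})"
      unfolding g_def stage_flow_def matrix_vector_mul_assoc [symmetric] by (rule has_vector_derivative_add)
    also have "(mexp ((b - t) *\<^sub>R A) *v (A *v x t + B *v u) + (- (A ** mexp ((b - t) *\<^sub>R A))) *v x t)
        + (- mexp ((b - t) *\<^sub>R A)) *v (B *v u) = 0"
      by (simp add: mexp_commutes matrix_vector_right_distrib matrix_vector_mul_assoc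
          bounded_bilinear.minus_left [OF bounded_bilinear_matrix_vector_mult]
          bounded_bilinear.minus_left [OF bounded_bilinear_matrix_mult])
    finally show ?thesis .
  qed
  then obtain c where "\<And>t. t \<in> {a..b} \<Longrightarrow> g t = c"
    using has_vector_derivative_zero_constant [of "{a..b}" g] by auto
  then have "g b = g a" using assms(2) by auto
  then show ?thesis by (simp add: g_def)
qed

text \<open>Duration and initial state vary together, as they do in the second stage. Since the
  exponential commutes with \<open>A\<close>, it can be factored out, leaving the velocity at the
  initial state.\<close>

lemma stage_flow_has_derivative:
  assumes \<tau>: "(\<tau> has_derivative \<tau>') (at z)" and g: "(g has_derivative g') (at z)"
    and pos: "0 < \<tau> z"
  shows "((\<lambda>z. stage_flow A B u (\<tau> z) (g z)) has_derivative
    (\<lambda>v. mexp (\<tau> z *\<^sub>R A) *v (g' v + \<tau>' v *\<^sub>R (A *v g z + B *v u)))) (at z)"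
proof -
  have E: "((\<lambda>z. mexp (\<tau> z *\<^sub>R A)) has_derivative (\<lambda>v. \<tau>' v *\<^sub>R (A ** mexp (\<tau> z *\<^sub>R A)))) (at z)"
    using diff_chain_at [OF \<tau> mexp_has_vector_derivative [unfolded has_vector_derivative_def], of A]
    by (simp add: o_def)
  have I: "((\<lambda>z. mexp_integral A (\<tau> z)) has_derivative (\<lambda>v. \<tau>' v *\<^sub>R mexp (\<tau> z *\<^sub>R A))) (at z)"
    using diff_chain_at [OF \<tau> mexp_integral_has_vector_derivative_at [unfolded has_vector_derivative_def, OF pos], of A]
    by (simp add: o_def)
  have "((\<lambda>z. mexp (\<tau> z *\<^sub>R A) *v g z) has_derivative
      (\<lambda>v. mexp (\<tau> z *\<^sub>R A) *v g' v + (\<tau>' v *\<^sub>R (A ** mexp (\<tau> z *\<^sub>R A))) *v g z)) (at z)"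
    by (rule bounded_bilinear.FDERIV [OF bounded_bilinear_matrix_vector_mult E g])
  moreover have "((\<lambda>z. mexp_integral A (\<tau> z) *v (B *v u)) has_derivative
      (\<lambda>v. (\<tau>' v *\<^sub>R mexp (\<tau> z *\<^sub>R A)) *v (B *v u))) (at z)"
    by (rule bounded_linear.has_derivative
        [OF bounded_bilinear.bounded_linear_left [OF bounded_bilinear_matrix_vector_mult] I])
  ultimately have "((\<lambda>z. stage_flow A B u (\<tau> z) (g z)) has_derivative
      (\<lambda>v. (mexp (\<tau> z *\<^sub>R A) *v g' v + (\<tau>' v *\<^sub>R (A ** mexp (\<tau> z *\<^sub>R A))) *v g z)
        + (\<tau>' v *\<^sub>R mexp (\<tau> z *\<^sub>R A)) *v (B *v u))) (at z)"
    unfolding stage_flow_def matrix_vector_mul_assoc [symmetric] by (rule has_derivative_add)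
  then show ?thesis
    by (simp add: mexp_commutes matrix_vector_right_distrib matrix_vector_mul_assoc
        scaleR_matrix_vector_assoc [symmetric] matrix_scaleR_mult_left matrix_vector_mult_scaleR add.assoc scaleR_add_right)
qed

section \<open>Implicit functions under differentiability at a point\<close>

text \<open>Only differentiability at the point \<^term>\<open>(\<delta> z, z)\<close> is available, so the library's
  inverse function theorems, which need continuous derivatives, do not apply.\<close>
lemma implicit_has_derivative:
  fixes F :: "real \<times> 'a::real_normed_vector \<Rightarrow> real"
  assumes F: "(F has_derivative (\<lambda>(s, v). c * s + L v)) (at (\<delta> z, z))"
    and c: "c \<noteq> 0" and cont: "isCont \<delta> z"
    and zero: "\<forall>\<^sub>F y in nhds z. F (\<delta> y, y) = 0"
  shows "(\<delta> has_derivative (\<lambda>v. - (L v / c))) (at z)"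
proof -
  have bl: "bounded_linear (\<lambda>(s, v). c * s + L v)"
    using F by (rule has_derivative_bounded_linear)
  \<comment> \<open>\<open>L\<close> is the joint derivative restricted to pairs with first
    component 0.\<close>
  have "bounded_linear (\<lambda>v. (\<lambda>(s, v). c * s + L v) (0 :: real, v))"
    by (rule bounded_linear_compose [OF bl]) (intro bounded_linear_intros)
  then have L: "bounded_linear L" by simp
  then obtain K where K: "\<And>v. \<bar>L v\<bar> \<le> norm v * K" "0 < K"
    using bounded_linear.pos_bounded by (metis real_norm_def)
  have F0: "F (\<delta> z, z) = 0"
    using zero by (rule eventually_nhds_x_imp_x)
  have lin: "\<forall>\<^sub>F y in nhds z. \<bar>c * (\<delta> y - \<delta> z) + L (y - z)\<bar> \<le> e * (\<bar>\<delta> y - \<delta> z\<bar> + norm (y - z))"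
    if "0 < e" for e
  proof -
    have "\<forall>\<^sub>F p in nhds (\<delta> z, z). norm (F p - F (\<delta> z, z) - (\<lambda>(s, v). c * s + L v) (p - (\<delta> z, z)))
        \<le> e * norm (p - (\<delta> z, z))"
      using F that unfolding has_derivative_at_alt eventually_nhds_metric dist_norm by blast
    moreover have "filterlim (\<lambda>y. (\<delta> y, y)) (nhds (\<delta> z, z)) (nhds z)"
      using cont by (intro tendsto_Pair filterlim_ident) (simp add: continuous_at tendsto_nhds_iff isCont_def)
    ultimately have "\<forall>\<^sub>F y in nhds z. norm (F (\<delta> y, y) - F (\<delta> z, z) - (\<lambda>(s, v). c * s + L v) ((\<delta> y, y) - (\<delta> z, z)))
        \<le> e * norm ((\<delta> y, y) - (\<delta> z, z))"
      by (rule eventually_compose_filterlim)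
    then show ?thesis
      using zero
    proof eventually_elim
      case (elim y)
      have "e * norm ((\<delta> y, y) - (\<delta> z, z)) \<le> e * (\<bar>\<delta> y - \<delta> z\<bar> + norm (y - z))"
        using that norm_Pair_le [of "\<delta> y - \<delta> z" "y - z"] by (intro mult_left_mono) auto
      with elim F0 show ?case by auto
    qed
  qed
  define M where "M = 2 * K / \<bar>c\<bar> + 1"
  have lip: "\<forall>\<^sub>F y in nhds z. \<bar>\<delta> y - \<delta> z\<bar> \<le> M * norm (y - z)"
  proof -
    \<comment> \<open>With this tolerance, half of the term |c|
      |\<open>\<delta> y - \<delta> z\<close>| is absorbed on the left; doubling what remains and
      dividing by |c| gives the constant \<open>M\<close>.\<close>
    have "0 < \<bar>c\<bar> / 2" using c by simp
    from lin [OF this] show ?thesis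
    proof eventually_elim
      case (elim y)
      have "\<bar>c\<bar> * \<bar>\<delta> y - \<delta> z\<bar> = \<bar>c * (\<delta> y - \<delta> z)\<bar>" by (simp add: abs_mult)
      also have "\<dots> \<le> \<bar>c * (\<delta> y - \<delta> z) + L (y - z)\<bar> + \<bar>L (y - z)\<bar>" by linarith
      finally have "\<bar>c\<bar> * \<bar>\<delta> y - \<delta> z\<bar> \<le> (2 * K + \<bar>c\<bar>) * norm (y - z)"
        using elim K(1) [of "y - z"] by (simp add: algebra_simps)
      then show ?case using c by (simp add: M_def field_simps)
    qed
  qed
  have M: "0 < M" unfolding M_def using K(2) by (simp add: add_nonneg_pos)
  show ?thesis
    unfolding has_derivative_at_alt
  proof (intro conjI allI impI)
    show "bounded_linear (\<lambda>v. - (L v / c))"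
      using L by (intro bounded_linear_minus bounded_linear_divide [THEN bounded_linear_compose])
    fix e :: real assume e: "0 < e"
    \<comment> \<open>Chosen so that \<open>e' * (M + 1)\<close> is \<open>e\<close> times
      |c|.\<close>
    define e' where "e' = e * \<bar>c\<bar> / (M + 1)"
    have e': "0 < e'" using e c M by (simp add: e'_def)
    have "\<forall>\<^sub>F y in nhds z. norm (\<delta> y - \<delta> z - - (L (y - z) / c)) \<le> e * norm (y - z)"
      using lin [OF e'] lip
    proof eventually_elim
      case (elim y)
      have "\<bar>c\<bar> * norm (\<delta> y - \<delta> z - - (L (y - z) / c)) = \<bar>c * (\<delta> y - \<delta> z) + L (y - z)\<bar>"
        using c by (simp add: abs_mult [symmetric] algebra_simps)
      also have "\<dots> \<le> e' * (M * norm (y - z) + norm (y - z))"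
        using elim e' by (smt (verit) mult_left_mono)
      also have "\<dots> = \<bar>c\<bar> * (e * norm (y - z))"
        using M by (simp add: e'_def field_simps)
      finally show ?case using c by simp
    qed
    then show "\<exists>d>0. \<forall>y. norm (y - z) < d \<longrightarrow> norm (\<delta> y - \<delta> z - - (L (y - z) / c)) \<le> e * norm (y - z)"
      unfolding eventually_nhds_metric dist_norm .
  qed
qed

text \<open>The implicit function is the zero closest to \<^term>\<open>d\<close>. Since \<^term>\<open>F\<close> is only assumed
  separately continuous, zeros need not be unique near \<^term>\<open>d\<close>, but the intermediate value theorem
  provides some arbitrarily close to it.\<close>
lemma implicit_function_exists_pos:
  fixes F :: "real \<Rightarrow> 'a::t2_space \<Rightarrow> real"
  assumes r: "0 < r"
    and cont_t: "\<And>z. continuous_on {d - r..d + r} (\<lambda>t. F t z)"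
    and cont_z: "\<And>t. t \<in> {d - r..d + r} \<Longrightarrow> isCont (F t) z0"
    and der: "((\<lambda>t. F t z0) has_real_derivative c) (at d)" and c: "0 < c"
    and zero: "F d z0 = 0"
  shows "\<exists>\<delta>. \<delta> z0 = d \<and> isCont \<delta> z0 \<and> (\<forall>\<^sub>F z in nhds z0. F (\<delta> z) z = 0)"
proof -
  define R where "R z = {t \<in> {d - r..d + r}. F t z = 0}" for z
  \<comment> \<open>The value is arbitrary where \<open>R z\<close> is empty; \<open>near\<close>
    excludes this for \<open>z\<close> close to \<open>z0\<close>.\<close>
  define \<delta> where "\<delta> z = (SOME t. t \<in> R z \<and> (\<forall>s\<in>R z. \<bar>t - d\<bar> \<le> \<bar>s - d\<bar>))" for z
  have \<delta>: "\<delta> z \<in> R z" "\<And>s. s \<in> R z \<Longrightarrow> \<bar>\<delta> z - d\<bar> \<le> \<bar>s - d\<bar>" if "R z \<noteq> {}" for z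
  proof -
    have "closed (R z)"
      unfolding R_def using continuous_closed_preimage [OF cont_t, of "{0}" z]
      by (simp add: vimage_def Int_def)
    moreover have "bounded (R z)"
      by (rule bounded_subset [of "{d - r..d + r}"]) (auto simp: R_def)
    ultimately have "compact (R z)" by (simp add: compact_eq_bounded_closed)
    moreover have "continuous_on (R z) (\<lambda>t. \<bar>t - d\<bar>)" by (intro continuous_intros)
    ultimately have "\<exists>t\<in>R z. \<forall>s\<in>R z. \<bar>t - d\<bar> \<le> \<bar>s - d\<bar>"
      using that by (intro continuous_attains_inf)
    then have "\<exists>t. t \<in> R z \<and> (\<forall>s\<in>R z. \<bar>t - d\<bar> \<le> \<bar>s - d\<bar>)" by blast
    from someI_ex [OF this] show "\<delta> z \<in> R z" "\<And>s. s \<in> R z \<Longrightarrow> \<bar>\<delta> z - d\<bar> \<le> \<bar>s - d\<bar>"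
      unfolding \<delta>_def [symmetric] by blast+
  qed
  have "d \<in> R z0" using r zero by (simp add: R_def)
  then have \<delta>0: "\<delta> z0 = d" using \<delta>(2) [of z0 d] by auto
  \<comment> \<open>The derivative at the single point \<open>d\<close> fixes the signs of
    \<open>F\<close> at \<open>z0\<close> on both sides of \<open>d\<close>.\<close>
  obtain p where p: "0 < p" "\<And>k. 0 < k \<Longrightarrow> k < p \<Longrightarrow> F d z0 < F (d + k) z0"
    using DERIV_pos_inc_right [OF der c] by blast
  obtain q where q: "0 < q" "\<And>k. 0 < k \<Longrightarrow> k < q \<Longrightarrow> F (d - k) z0 < F d z0"
    using DERIV_pos_inc_left [OF der c] by blast
  have tends: "filterlim (F t) (nhds (F t z0)) (nhds z0)" if "t \<in> {d - r..d + r}" for t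
    using cont_z [OF that] by (simp add: isCont_def tendsto_at_iff_tendsto_nhds)
  have near: "\<forall>\<^sub>F z in nhds z0. R z \<noteq> {} \<and> \<bar>\<delta> z - d\<bar> < e" if e: "0 < e" for e
  proof -
    \<comment> \<open>Below \<open>p\<close> and \<open>q\<close> the signs are known, below
      \<open>r\<close> the continuity in time is, and below \<open>e\<close> the zero found is close
      enough. Continuity in \<open>z\<close> is used at the two times \<open>d - k\<close> and
      \<open>d + k\<close> only, to carry the signs over to nearby \<open>z\<close>.\<close>
    define k where "k = min (min p q) (min r e) / 2"
    have k: "0 < k" "k < p" "k < q" "k < r" "k < e"
      using p(1) q(1) r e by (auto simp: k_def min_def)
    have "\<forall>\<^sub>F z in nhds z0. 0 < F (d + k) z"
      using k p(2) [of k] zero by (intro order_tendstoD(1) [OF tends]) auto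
    moreover have "\<forall>\<^sub>F z in nhds z0. F (d - k) z < 0"
      using k q(2) [of k] zero by (intro order_tendstoD(2) [OF tends]) auto
    ultimately show ?thesis
    proof eventually_elim
      case (elim z)
      have "\<exists>t\<ge>d - k. t \<le> d + k \<and> F t z = 0"
        using elim k by (intro IVT' continuous_on_subset [OF cont_t]) auto
      then obtain t where "d - k \<le> t" "t \<le> d + k" "F t z = 0" by blast
      then have "t \<in> R z" "\<bar>t - d\<bar> \<le> k" using k by (auto simp: R_def)
      with \<delta>(2) [of z t] k show ?case by force
    qed
  qed
  have "isCont \<delta> z0"
    unfolding isCont_def \<delta>0
  proof (rule tendstoI)
    fix e :: real assume "0 < e"
    from near [OF this] have "\<forall>\<^sub>F z in nhds z0. dist (\<delta> z) d < e"
      by eventually_elim (simp add: dist_real_def)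
    then show "\<forall>\<^sub>F z in at z0. dist (\<delta> z) d < e"
      by (simp add: eventually_nhds_conv_at)
  qed
  moreover have "\<forall>\<^sub>F z in nhds z0. F (\<delta> z) z = 0"
    using near [OF zero_less_one] by eventually_elim (use \<delta>(1) in \<open>auto simp: R_def\<close>)
  ultimately show ?thesis using \<delta>0 by blast
qed

lemma implicit_function_exists:
  fixes F :: "real \<Rightarrow> 'a::t2_space \<Rightarrow> real"
  assumes r: "0 < r"
    and cont_t: "\<And>z. continuous_on {d - r..d + r} (\<lambda>t. F t z)"
    and cont_z: "\<And>t. t \<in> {d - r..d + r} \<Longrightarrow> isCont (F t) z0"
    and der: "((\<lambda>t. F t z0) has_real_derivative c) (at d)" and c: "c \<noteq> 0"
    and zero: "F d z0 = 0"
  shows "\<exists>\<delta>. \<delta> z0 = d \<and> isCont \<delta> z0 \<and> (\<forall>\<^sub>F z in nhds z0. F (\<delta> z) z = 0)"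
proof (cases "0 < c")
  case True
  with assms show ?thesis by (intro implicit_function_exists_pos [of r d F z0 c]) auto
next
  case False
  \<comment> \<open>Changing the sign of \<open>F\<close> reduces a negative slope to the positive
    case.\<close>
  have "\<exists>\<delta>. \<delta> z0 = d \<and> isCont \<delta> z0 \<and> (\<forall>\<^sub>F z in nhds z0. - F (\<delta> z) z = 0)"
    using assms False
    by (intro implicit_function_exists_pos [of r d "\<lambda>t z. - F t z" z0 "- c"])
      (auto intro!: continuous_intros derivative_eq_intros)
  then show ?thesis by simp
qed

section \<open>Matrix inverses and the transport of velocities by the flow\<close>

lemma matrix_inv_left:
  assumes "invertible M"
  shows "matrix_inv M ** M = mat 1"
  using someI_ex [OF assms [unfolded invertible_def]] by (simp add: matrix_inv_def)

lemma matrix_vector_mult_eq_iff: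
  fixes E F :: "real^'n^'n"
  assumes FE: "F ** E = mat 1"
  shows "E *v a = b \<longleftrightarrow> a = F *v b"
proof -
  have "E ** F = mat 1" using FE by (simp add: matrix_left_right_inverse)
  with FE show ?thesis by (auto simp: matrix_vector_mul_assoc)
qed

text \<open>Fundamental theorem of calculus: the integrand becomes the derivative of the exponential
  once \<open>A\<close> is moved inside.\<close>

lemma matrix_mult_mexp_integral:
  assumes "0 \<le> t"
  shows "A ** mexp_integral A t = mexp (t *\<^sub>R A) - mat 1"
proof -
  have "((\<lambda>s. A ** mexp (s *\<^sub>R A)) has_integral mexp (t *\<^sub>R A) - mexp (0 *\<^sub>R A)) {0..t}"
    using assms by (intro fundamental_theorem_of_calculus mexp_has_vector_derivative)
  moreover have "((\<lambda>s. A ** mexp (s *\<^sub>R A)) has_integral A ** mexp_integral A t) {0..t}"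
    using has_integral_linear [OF integrable_integral [OF integrable_continuous_interval [OF continuous_on_mexp]]
        bounded_bilinear.bounded_linear_right [OF bounded_bilinear_matrix_mult]]
    by (simp add: o_def mexp_integral_def)
  ultimately have "mexp (t *\<^sub>R A) - mexp (0 *\<^sub>R A) = A ** mexp_integral A t"
    by (rule has_integral_unique)
  then show ?thesis by simp
qed

text \<open>The linearized flow maps the vector field at \<open>z\<close> to the vector field at the
  state reached. This replaces velocities at the start of a stage by those at the switching
  instant.\<close>

lemma mexp_mult_velocity:
  assumes "0 \<le> t"
  shows "mexp (t *\<^sub>R A) *v (A *v z + B *v u) = A *v stage_flow A B u t z + B *v u"
proof -
  have "A *v stage_flow A B u t z = mexp (t *\<^sub>R A) *v (A *v z) + (A ** mexp_integral A t) *v (B *v u)"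
    by (simp add: stage_flow_def matrix_vector_right_distrib matrix_vector_mul_assoc mexp_commutes matrix_mul_assoc)
  then show ?thesis
    unfolding matrix_mult_mexp_integral [OF assms]
    by (simp add: matrix_vector_right_distrib matrix_vector_mult_diff_rdistrib)
qed

section \<open>Derivatives of the switching condition and of the period map\<close>

lemma bounded_linear_first_row_mult: "bounded_linear (\<lambda>v. (C *v v) $ 1)" for C :: "real^'n^1"
  by (intro bounded_linear_compose [OF bounded_linear_vec_nth] matrix_vector_mul_bounded_linear)

lemma converter_output_has_derivative:
  assumes "(g has_derivative g') F"
  shows "((\<lambda>p. converter_output C D u (g p)) has_derivative (\<lambda>v. (C *v g' v) $ 1)) F"
proof -
  have "((\<lambda>p. (C *v g p) $ 1 + (D *v u) $ 1) has_derivative (\<lambda>v. (C *v g' v) $ 1 + 0)) F"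
    by (intro has_derivative_add has_derivative_const
        bounded_linear.has_derivative [OF bounded_linear_first_row_mult assms])
  then show ?thesis by (simp add: converter_output_def)
qed

lemma switching_function_has_derivative:
  assumes d: "0 < d" and h: "(h has_real_derivative h') (at d)"
  shows "((\<lambda>p. converter_output C D u (stage_flow A B u (fst p) (snd p)) - h (fst p)) has_derivative
    (\<lambda>(s, v). ((C *v (A *v stage_flow A B u d z + B *v u)) $ 1 - h') * s
      + (C *v (mexp (d *\<^sub>R A) *v v)) $ 1)) (at (d, z))"
proof -
  have "((\<lambda>p. stage_flow A B u (fst p) (snd p)) has_derivative
      (\<lambda>v. mexp (fst (d, z) *\<^sub>R A) *v (snd v + fst v *\<^sub>R (A *v snd (d, z) + B *v u)))) (at (d, z))"
    using d by (intro stage_flow_has_derivative has_derivative_fst has_derivative_snd has_derivative_ident) auto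
  moreover have "((\<lambda>p. h (fst p)) has_derivative (\<lambda>v. h' * fst v)) (at (d, z))"
    using h by (intro has_derivative_compose [OF has_derivative_fst [OF has_derivative_ident]])
      (simp add: has_field_derivative_def)
  ultimately have "((\<lambda>p. converter_output C D u (stage_flow A B u (fst p) (snd p)) - h (fst p)) has_derivative
      (\<lambda>v. (C *v (mexp (fst (d, z) *\<^sub>R A) *v (snd v + fst v *\<^sub>R (A *v snd (d, z) + B *v u)))) $ 1 - h' * fst v)) (at (d, z))"
    by (intro has_derivative_diff converter_output_has_derivative)
  also have "(\<lambda>v. (C *v (mexp (fst (d, z) *\<^sub>R A) *v (snd v + fst v *\<^sub>R (A *v snd (d, z) + B *v u)))) $ 1 - h' * fst v)
      = (\<lambda>(s, v). ((C *v (A *v stage_flow A B u d z + B *v u)) $ 1 - h') * s + (C *v (mexp (d *\<^sub>R A) *v v)) $ 1)"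
  proof -
    have "mexp (d *\<^sub>R A) *v (v + s *\<^sub>R (A *v z + B *v u))
        = mexp (d *\<^sub>R A) *v v + s *\<^sub>R (A *v stage_flow A B u d z + B *v u)" for s v
      using d by (simp only: matrix_vector_right_distrib [of _ v] matrix_vector_mult_scaleR
          mexp_mult_velocity less_imp_le)
    then show ?thesis
      by (simp add: fun_eq_iff matrix_vector_right_distrib matrix_vector_mult_scaleR algebra_simps)
  qed
  finally show ?thesis .
qed

lemma stage_flow_has_derivative_time:
  assumes "0 < t"
  shows "((\<lambda>t. stage_flow A B u t z) has_vector_derivative A *v stage_flow A B u t z + B *v u) (at t)"
  using stage_flow_has_derivative [OF has_derivative_ident has_derivative_const, of t A B u z] assms
    mexp_mult_velocity [of t A z B u]
  by (simp add: has_vector_derivative_def matrix_vector_mult_scaleR)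

text \<open>Transversality says that output minus ramp has nonzero slope at \<open>d\<close>, which
  is what \<open>implicit_function_exists\<close> requires.\<close>

lemma local_switching_instant_exists:
  assumes d: "0 < d" "d < T" and h: "\<And>t. 0 < t \<Longrightarrow> t < T \<Longrightarrow> h differentiable (at t)"
    and switch: "converter_output C D u (stage_flow A B u d z) = h d"
    and transversal: "(C *v (A *v stage_flow A B u d z + B *v u)) $ 1 \<noteq> deriv h d"
  shows "\<exists>\<delta>. local_switching_instant A B C D u h d z \<delta>"
proof -
  define F where "F t z = converter_output C D u (stage_flow A B u t z) - h t" for t z
  \<comment> \<open>Half the distance to the nearer end of the cycle keeps the interval inside (0,
    T), where both ramp and flow are differentiable in time.\<close>
  define r where "r = min d (T - d) / 2"
  have r: "0 < r" and Ir: "\<And>t. t \<in> {d - r..d + r} \<Longrightarrow> 0 < t \<and> t < T"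
    using d by (auto simp: r_def min_def field_simps split: if_splits)
  have hd: "(h has_real_derivative deriv h t) (at t)" if "0 < t" "t < T" for t
    using h [OF that] by (simp add: DERIV_deriv_iff_real_differentiable)
  have der: "((\<lambda>t. F t z) has_real_derivative (C *v (A *v stage_flow A B u t z + B *v u)) $ 1 - deriv h t) (at t)"
    if "0 < t" "t < T" for t z
  proof -
    have "((\<lambda>t. F t z) has_derivative
        (\<lambda>s. (C *v (s *\<^sub>R (A *v stage_flow A B u t z + B *v u))) $ 1 - deriv h t * s)) (at t)"
      unfolding F_def
      using stage_flow_has_derivative_time [OF that(1), of A B u z] hd [OF that]
      by (intro has_derivative_diff converter_output_has_derivative)
        (simp_all add: has_vector_derivative_def has_field_derivative_def)
    also have "(\<lambda>s. (C *v (s *\<^sub>R (A *v stage_flow A B u t z + B *v u))) $ 1 - deriv h t * s)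
        = (*) ((C *v (A *v stage_flow A B u t z + B *v u)) $ 1 - deriv h t)"
      by (simp add: fun_eq_iff matrix_vector_mult_scaleR right_diff_distrib mult.commute)
    finally show ?thesis
      by (simp add: has_field_derivative_def)
  qed
  have "\<exists>\<delta>. \<delta> z = d \<and> isCont \<delta> z \<and> (\<forall>\<^sub>F y in nhds z. F (\<delta> y) y = 0)"
  proof (rule implicit_function_exists [OF r])
    show "continuous_on {d - r..d + r} (\<lambda>t. F t y)" for y
      using der Ir by (intro continuous_at_imp_continuous_on ballI DERIV_isCont) blast
    show "isCont (F t) z" for t
      unfolding F_def stage_flow_def converter_output_def
      by (intro continuous_intros bounded_linear.isCont [OF bounded_linear_vec_nth]
          bounded_linear.isCont [OF matrix_vector_mul_bounded_linear])
    show "((\<lambda>t. F t z) has_real_derivative (C *v (A *v stage_flow A B u d z + B *v u)) $ 1 - deriv h d) (at d)"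
      using d by (rule der)
  qed (use transversal switch in \<open>auto simp: F_def\<close>)
  then show ?thesis
    by (simp add: local_switching_instant_def F_def)
qed

text \<open>A perturbation \<open>v\<close> moves the switching instant by
  \<open>- ((C *v (E1 *v v)) $ 1 / c)\<close>. One stage is lengthened as much as the other is
  shortened, so to first order only the jump of the velocity at \<open>xd\<close> enters.\<close>

lemma sampled_data_map_has_derivative:
  fixes A1 A2 :: "real^'n^'n" and z :: "real^'n"
  assumes d: "0 < d" "d < T" and h: "h differentiable (at d)"
    and \<delta>: "local_switching_instant A1 B1 C D u h d z \<delta>"
    and xd: "xd = stage_flow A1 B1 u d z"
    and c: "c = (C *v (A1 *v xd + B1 *v u)) $ 1 - deriv h d" "c \<noteq> 0"
  shows "(sampled_data_map A1 B1 A2 B2 u T \<delta> has_derivative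
    (\<lambda>v. mexp ((T - d) *\<^sub>R A2) *v (mexp (d *\<^sub>R A1) *v v
      - ((C *v (mexp (d *\<^sub>R A1) *v v)) $ 1 / c) *\<^sub>R ((A1 - A2) *v xd + (B1 - B2) *v u)))) (at z)"
proof -
  define E1 where "E1 = mexp (d *\<^sub>R A1)"
  have \<delta>z: "\<delta> z = d" and "isCont \<delta> z"
    and zero: "\<forall>\<^sub>F y in nhds z. converter_output C D u (stage_flow A1 B1 u (\<delta> y) y) = h (\<delta> y)"
    using \<delta> by (auto simp: local_switching_instant_def)
  have "(h has_real_derivative deriv h d) (at d)"
    using h by (simp add: DERIV_deriv_iff_real_differentiable)
  from switching_function_has_derivative [OF d(1) this, of C D u A1 B1 z]
  have "((\<lambda>p. converter_output C D u (stage_flow A1 B1 u (fst p) (snd p)) - h (fst p)) has_derivative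
      (\<lambda>(s, v). c * s + (C *v (E1 *v v)) $ 1)) (at (\<delta> z, z))"
    by (simp add: \<delta>z E1_def c(1) xd)
  then have \<delta>': "(\<delta> has_derivative (\<lambda>v. - ((C *v (E1 *v v)) $ 1 / c))) (at z)"
    by (rule implicit_has_derivative [OF _ c(2) \<open>isCont \<delta> z\<close>]) (use zero in simp)
  have "((\<lambda>y. stage_flow A1 B1 u (\<delta> y) y) has_derivative
      (\<lambda>v. E1 *v (v + (- ((C *v (E1 *v v)) $ 1 / c)) *\<^sub>R (A1 *v z + B1 *v u)))) (at z)"
    using stage_flow_has_derivative [OF \<delta>' has_derivative_ident, of A1 B1 u] d(1)
    by (simp add: \<delta>z E1_def)
  moreover have "E1 *v (A1 *v z + B1 *v u) = A1 *v xd + B1 *v u"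
    unfolding E1_def xd using d(1) by (intro mexp_mult_velocity) simp
  ultimately have flow1: "((\<lambda>y. stage_flow A1 B1 u (\<delta> y) y) has_derivative
      (\<lambda>v. E1 *v v + (- ((C *v (E1 *v v)) $ 1 / c)) *\<^sub>R (A1 *v xd + B1 *v u))) (at z)"
    by (simp only: matrix_vector_right_distrib matrix_vector_mult_scaleR)
  have "((\<lambda>y. T - \<delta> y) has_derivative (\<lambda>v. (C *v (E1 *v v)) $ 1 / c)) (at z)"
    using has_derivative_diff [OF has_derivative_const \<delta>', of T] by simp
  from stage_flow_has_derivative [OF this flow1, of A2 B2 u]
  have "((\<lambda>y. stage_flow A2 B2 u (T - \<delta> y) (stage_flow A1 B1 u (\<delta> y) y)) has_derivative
     (\<lambda>v. mexp ((T - d) *\<^sub>R A2) *v (E1 *v v + (- ((C *v (E1 *v v)) $ 1 / c)) *\<^sub>R (A1 *v xd + B1 *v u)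
        + ((C *v (E1 *v v)) $ 1 / c) *\<^sub>R (A2 *v xd + B2 *v u)))) (at z)"
    using d(2) by (simp add: \<delta>z xd)
  moreover have "E1 *v v + (- k) *\<^sub>R (A1 *v xd + B1 *v u) + k *\<^sub>R (A2 *v xd + B2 *v u)
      = E1 *v v - k *\<^sub>R ((A1 - A2) *v xd + (B1 - B2) *v u)" for k :: real and v
    by (simp add: matrix_vector_mult_diff_rdistrib algebra_simps)
  ultimately show ?thesis
    unfolding sampled_data_map_def E1_def by (simp only:)
qed

section \<open>The eigenvalue 1 of the Jacobian\<close>

text \<open>With \<^term>\<open>y = E1 *v v\<close> the eigenvalue equation reads
  \<^term>\<open>(mat 1 - F2 ** F1) *v y = ((C *v y) $ 1 / c) *\<^sub>R w\<close>.\<close>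
lemma rank_one_perturbation_fixed_vector_iff:
  fixes E1 E2 F1 F2 :: "real^'n^'n" and C :: "real^'n^1"
  assumes E1: "F1 ** E1 = mat 1" and E2: "F2 ** E2 = mat 1"
    and inv: "invertible (mat 1 - F2 ** F1)" and c: "c \<noteq> 0"
  shows "(\<exists>v. v \<noteq> 0 \<and> E2 *v (E1 *v v - ((C *v (E1 *v v)) $ 1 / c) *\<^sub>R w) = v)
    \<longleftrightarrow> (C *v (matrix_inv (mat 1 - F2 ** F1) *v w)) $ 1 = c" (is "?L \<longleftrightarrow> ?R")
proof -
  define M where "M = mat 1 - F2 ** F1"
  have M: "matrix_inv M ** M = mat 1"
    using inv unfolding M_def by (rule matrix_inv_left)
  have E1': "E1 ** F1 = mat 1"
    using E1 by (simp add: matrix_left_right_inverse)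
  have eq: "E2 *v (y - k *\<^sub>R w) = F1 *v y \<longleftrightarrow> y = k *\<^sub>R (matrix_inv M *v w)" for k y
  proof -
    have "E2 *v (y - k *\<^sub>R w) = F1 *v y \<longleftrightarrow> y - k *\<^sub>R w = F2 *v (F1 *v y)"
      by (rule matrix_vector_mult_eq_iff [OF E2])
    also have "\<dots> \<longleftrightarrow> M *v y = k *\<^sub>R w"
      by (auto simp: M_def matrix_vector_mult_diff_rdistrib matrix_vector_mul_assoc algebra_simps)
    also have "\<dots> \<longleftrightarrow> y = matrix_inv M *v (k *\<^sub>R w)"
      by (rule matrix_vector_mult_eq_iff [OF M])
    finally show ?thesis by (simp add: matrix_vector_mult_scaleR)
  qed
  \<comment> \<open>Substitute \<open>y = E1 *v v\<close>, so \<open>v = F1 *v y\<close>;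
    invertibility of \<open>E1\<close> preserves nonzero vectors.\<close>
  have "?L \<longleftrightarrow> (\<exists>y. y \<noteq> 0 \<and> E2 *v (y - ((C *v y) $ 1 / c) *\<^sub>R w) = F1 *v y)"
  proof
    assume ?L
    then obtain v where v: "v \<noteq> 0" "E2 *v (E1 *v v - ((C *v (E1 *v v)) $ 1 / c) *\<^sub>R w) = v" by blast
    have "F1 *v (E1 *v v) = v" by (simp add: matrix_vector_mul_assoc E1)
    with v show "\<exists>y. y \<noteq> 0 \<and> E2 *v (y - ((C *v y) $ 1 / c) *\<^sub>R w) = F1 *v y"
      by (intro exI [of _ "E1 *v v"]) auto
  next
    assume "\<exists>y. y \<noteq> 0 \<and> E2 *v (y - ((C *v y) $ 1 / c) *\<^sub>R w) = F1 *v y"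
    then obtain y where y: "y \<noteq> 0" "E2 *v (y - ((C *v y) $ 1 / c) *\<^sub>R w) = F1 *v y" by blast
    have "E1 *v (F1 *v y) = y" by (simp add: matrix_vector_mul_assoc E1')
    with y show ?L by (intro exI [of _ "F1 *v y"]) auto
  qed
  also have "\<dots> \<longleftrightarrow> (\<exists>y. y \<noteq> 0 \<and> y = ((C *v y) $ 1 / c) *\<^sub>R (matrix_inv M *v w))"
    by (simp only: eq)
  also have "\<dots> \<longleftrightarrow> ?R"
  proof
    assume "\<exists>y. y \<noteq> 0 \<and> y = ((C *v y) $ 1 / c) *\<^sub>R (matrix_inv M *v w)"
    then obtain y where y: "y \<noteq> 0" "y = ((C *v y) $ 1 / c) *\<^sub>R (matrix_inv M *v w)" by blast
    \<comment> \<open>Otherwise the right-hand side of the equation for \<open>y\<close> vanishes.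
      The factor can therefore be cancelled below.\<close>
    then have "(C *v y) $ 1 \<noteq> 0" by auto
    moreover have "(C *v y) $ 1 = (C *v y) $ 1 / c * (C *v (matrix_inv M *v w)) $ 1"
      using arg_cong [OF y(2), of "\<lambda>y. (C *v y) $ 1"] by (simp add: matrix_vector_mult_scaleR)
    ultimately show ?R using c by (simp add: M_def field_simps)
  next
    assume ?R
    with c show "\<exists>y. y \<noteq> 0 \<and> y = ((C *v y) $ 1 / c) *\<^sub>R (matrix_inv M *v w)"
      \<comment> \<open>For this witness \<open>(C *v y) $ 1 = c\<close>, so its scalar factor is 1;
        it is nonzero because \<open>c\<close> is.\<close>
      by (intro exI [of _ "matrix_inv M *v w"]) (auto simp: M_def)
  qed
  finally show ?thesis .
qed

text \<open>\<open>F2 ** F1\<close> inverts \<open>E1 ** E2\<close>, so the matrix equals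
  \<open>(- (F2 ** F1)) ** (mat 1 - E1 ** E2)\<close>, a product of invertible ones. Thus the
  inverse in the boundary condition exists as soon as the one in \<open>X_mat\<close> does.\<close>

lemma invertible_one_minus_inverse_product:
  fixes E1 E2 F1 F2 :: "real^'n^'n"
  assumes E1: "F1 ** E1 = mat 1" and E2: "F2 ** E2 = mat 1"
    and inv: "invertible (mat 1 - E1 ** E2)"
  shows "invertible (mat 1 - F2 ** F1)"
proof -
  have "F2 ** F1 ** (E1 ** E2) = F2 ** (F1 ** E1) ** E2"
    by (simp add: matrix_mul_assoc)
  then have inverse: "F2 ** F1 ** (E1 ** E2) = mat 1"
    by (simp add: E1 E2)
  then have "mat 1 - F2 ** F1 = (- (F2 ** F1)) ** (mat 1 - E1 ** E2)"
    by (simp add: bounded_bilinear.diff_right [OF bounded_bilinear_matrix_mult]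
        bounded_bilinear.minus_left [OF bounded_bilinear_matrix_mult])
  moreover have "(- (F2 ** F1)) ** (- (E1 ** E2)) = mat 1"
    using inverse by (simp add: bounded_bilinear.minus_left [OF bounded_bilinear_matrix_mult]
        bounded_bilinear.minus_right [OF bounded_bilinear_matrix_mult])
  then have "invertible (- (F2 ** F1))"
    unfolding invertible_right_inverse by (rule exI)
  ultimately show ?thesis
    using inv by (simp add: invertible_mult)
qed

lemma saddle_node_bifurcation_iff_boundary:
  fixes A1 A2 :: "real^'n^'n"
  assumes d: "0 < d" "d < T" and h: "\<And>t. 0 < t \<Longrightarrow> t < T \<Longrightarrow> h differentiable (at t)"
    and x0: "periodic_solution A1 B1 A2 B2 C D u h T d x0"
    and inv: "invertible (mat 1 - mexp (d *\<^sub>R A1) ** mexp ((T - d) *\<^sub>R A2))"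
    and transversal: "(C *v (A1 *v x0 d + B1 *v u)) $ 1 \<noteq> deriv h d"
  shows "saddle_node_bifurcation A1 B1 A2 B2 C D u h T d x0
    \<longleftrightarrow> saddle_node_boundary A1 B1 A2 B2 C u h T d x0"
proof -
  define E1 E2 where E: "E1 = mexp (d *\<^sub>R A1)" "E2 = mexp ((T - d) *\<^sub>R A2)"
  define M where "M = mat 1 - mexp (- ((T - d) *\<^sub>R A2)) ** mexp (- (d *\<^sub>R A1))"
  define c where "c = (C *v (A1 *v x0 d + B1 *v u)) $ 1 - deriv h d"
  define w where "w = (A1 - A2) *v x0 d + (B1 - B2) *v u"
  define P where "P v = E2 *v (E1 *v v - ((C *v (E1 *v v)) $ 1 / c) *\<^sub>R w)" for v
  have c: "c \<noteq> 0" using transversal by (simp add: c_def)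
  have xd: "x0 d = stage_flow A1 B1 u d (x0 0)"
    using stage_solution_eq_flow [of A1 B1 u x0 0 d] x0 d by (simp add: periodic_solution_def)
  have der: "(sampled_data_map A1 B1 A2 B2 u T \<delta> has_derivative P) (at (x0 0))"
    if "local_switching_instant A1 B1 C D u h d (x0 0) \<delta>" for \<delta>
    using sampled_data_map_has_derivative [OF d h [OF d] that xd c_def c, of A2 B2]
    by (simp add: P_def [abs_def] w_def E)
  \<comment> \<open>The Jacobian is defined through some switching instant, so the direction from
    the boundary condition to the bifurcation needs one to exist.\<close>
  obtain \<delta> where \<delta>: "local_switching_instant A1 B1 C D u h d (x0 0) \<delta>"
    using local_switching_instant_exists [OF d h, of C D u A1 B1 "x0 0"] x0 transversal
    by (auto simp: periodic_solution_def xd)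
  \<comment> \<open>Every admissible switching instant yields the same derivative \<open>P\<close>,
    so the Jacobian does not depend on the choice.\<close>
  have jac: "sampled_data_jacobian A1 B1 A2 B2 C D u h T d (x0 0) J \<longleftrightarrow> (\<forall>v. J *v v = P v)" for J
    unfolding sampled_data_jacobian_def
  proof
    assume "\<exists>\<delta>. local_switching_instant A1 B1 C D u h d (x0 0) \<delta> \<and>
      (sampled_data_map A1 B1 A2 B2 u T \<delta> has_derivative (*v) J) (at (x0 0))"
    then obtain \<delta>' where "local_switching_instant A1 B1 C D u h d (x0 0) \<delta>'"
      and "(sampled_data_map A1 B1 A2 B2 u T \<delta>' has_derivative (*v) J) (at (x0 0))"
      by blast
    with der have "(*v) J = P"
      by (intro has_derivative_unique [of "sampled_data_map A1 B1 A2 B2 u T \<delta>'"])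
    then show "\<forall>v. J *v v = P v" by simp
  next
    assume "\<forall>v. J *v v = P v"
    then have "(*v) J = P" by auto
    with \<delta> der [OF \<delta>] show "\<exists>\<delta>. local_switching_instant A1 B1 C D u h d (x0 0) \<delta> \<and>
      (sampled_data_map A1 B1 A2 B2 u T \<delta> has_derivative (*v) J) (at (x0 0))" by auto
  qed
  have "linear P"
    using der [OF \<delta>] by (rule has_derivative_linear)
  then have matrix_P: "matrix P *v v = P v" for v
    by (rule matrix_vector_mul(2) [THEN fun_cong])
  have "saddle_node_bifurcation A1 B1 A2 B2 C D u h T d x0 \<longleftrightarrow> (\<exists>v. v \<noteq> 0 \<and> P v = v)"
  proof
    assume "saddle_node_bifurcation A1 B1 A2 B2 C D u h T d x0"
    then obtain J v where "\<forall>v. J *v v = P v" "v \<noteq> 0" "J *v v = 1 *\<^sub>R v"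
      unfolding saddle_node_bifurcation_def jac has_eigenvalue_def by blast
    then show "\<exists>v. v \<noteq> 0 \<and> P v = v"
      by (intro exI [of _ v]) simp
  next
    assume "\<exists>v. v \<noteq> 0 \<and> P v = v"
    then have "has_eigenvalue (matrix P) 1"
      by (simp add: has_eigenvalue_def matrix_P)
    then show "saddle_node_bifurcation A1 B1 A2 B2 C D u h T d x0"
      unfolding saddle_node_bifurcation_def jac using matrix_P by blast
  qed
  also have "\<dots> \<longleftrightarrow> (C *v (matrix_inv M *v w)) $ 1 = c"
    unfolding P_def M_def E
    by (rule rank_one_perturbation_fixed_vector_iff [OF mexp_minus_mult mexp_minus_mult
          invertible_one_minus_inverse_product [OF mexp_minus_mult mexp_minus_mult inv] c])
  also have "\<dots> \<longleftrightarrow> saddle_node_boundary A1 B1 A2 B2 C u h T d x0"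
    unfolding saddle_node_boundary_def c_def w_def M_def by auto
  finally show ?thesis .
qed

section \<open>The steady state for equal input matrices and the source voltage\<close>

text \<open>Going once around the cycle from the switching instant makes \<open>x0 d\<close> a fixed
  point of an affine map, whose equation is solved with the assumed inverse.\<close>

lemma periodic_solution_switching_state:
  assumes d: "0 < d" "d < T" and x0: "periodic_solution A1 B A2 B C D u h T d x0"
    and inv: "invertible (mat 1 - mexp (d *\<^sub>R A1) ** mexp ((T - d) *\<^sub>R A2))"
  shows "x0 d = X_mat A1 A2 T d *v (B *v u)"
proof -
  define M where "M = mat 1 - mexp (d *\<^sub>R A1) ** mexp ((T - d) *\<^sub>R A2)"
  define N where "N = mexp (d *\<^sub>R A1) ** mexp_integral A2 (T - d) + mexp_integral A1 d"
  have "x0 d = stage_flow A1 B u d (x0 0)"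
    using stage_solution_eq_flow [of A1 B u x0 0 d] x0 d by (simp add: periodic_solution_def)
  \<comment> \<open>The second stage ends in \<open>x0 T\<close>, which is \<open>x0 0\<close> by
    periodicity.\<close>
  moreover have "x0 0 = stage_flow A2 B u (T - d) (x0 d)"
    using stage_solution_eq_flow [of A2 B u x0 d T] x0 d
    unfolding periodic_solution_def by (metis add_0 less_imp_le)
  ultimately have "x0 d = stage_flow A1 B u d (stage_flow A2 B u (T - d) (x0 d))"
    by (rule subst [rotated])
  moreover have "stage_flow A1 B u d (stage_flow A2 B u (T - d) z)
      = (mexp (d *\<^sub>R A1) ** mexp ((T - d) *\<^sub>R A2)) *v z + N *v (B *v u)" for z
    by (simp add: stage_flow_def N_def matrix_vector_mult_add_rdistrib matrix_vector_right_distrib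
        matrix_vector_mul_assoc matrix_mul_assoc bounded_bilinear.add_left [OF bounded_bilinear_matrix_mult])
  ultimately have "x0 d = (mexp (d *\<^sub>R A1) ** mexp ((T - d) *\<^sub>R A2)) *v x0 d + N *v (B *v u)"
    by (rule trans)
  then have "x0 d - (mexp (d *\<^sub>R A1) ** mexp ((T - d) *\<^sub>R A2)) *v x0 d = N *v (B *v u)"
    unfolding diff_eq_eq by (subst add.commute)
  then have "M *v x0 d = N *v (B *v u)"
    by (simp add: M_def matrix_vector_mult_diff_rdistrib)
  then have "matrix_inv M *v (M *v x0 d) = (matrix_inv M ** N) *v (B *v u)"
    by (simp add: matrix_vector_mul_assoc matrix_mul_assoc)
  moreover have "matrix_inv M ** M = mat 1"
    using inv unfolding M_def by (rule matrix_inv_left)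
  ultimately show ?thesis
    by (simp add: X_mat_def M_def N_def matrix_vector_mul_assoc)
qed

text \<open>The first equivalence is the eigenvalue argument. The other two are linear algebra:
  insert the formula for \<open>x0 d\<close> into the boundary condition, then split
  \<open>B1 *v u\<close> along the columns of \<open>B1\<close>.\<close>

theorem mainTheorem5:
  fixes A1 A2 :: "real^'n^'n" and B1 B2 :: "real^2^'n"
    and C :: "real^'n^1" and D :: "real^2^1"
    and u :: "real^2" and v_s v_r :: real
    and h :: "real \<Rightarrow> real" and T d :: real
    and x0 :: "real \<Rightarrow> real^'n"
  assumes u: "u = vector [v_s, v_r]"
    and d: "0 < d" "d < T"
    and h_periodic: "\<And>t. h (t + T) = h t"
    and h_diff: "\<And>t. 0 < t \<Longrightarrow> t < T \<Longrightarrow> h differentiable (at t)"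
    and x0: "periodic_solution A1 B1 A2 B2 C D u h T d x0"
    and inv: "invertible (mat 1 - mexp (d *\<^sub>R A1) ** mexp ((T - d) *\<^sub>R A2))"
    and B: "B1 = B2"
  shows "((C *v (A1 *v x0 d + B1 *v u)) $ 1 \<noteq> deriv h d \<longrightarrow>
            (saddle_node_bifurcation A1 B1 A2 B2 C D u h T d x0
             \<longleftrightarrow> saddle_node_boundary A1 B1 A2 B2 C u h T d x0))
       \<and> (saddle_node_boundary A1 B1 A2 B2 C u h T d x0
          \<longleftrightarrow> (C ** Lambda_mat A1 A2 T d ** B1 *v u) $ 1 = deriv h d)
       \<and> ((C ** Lambda_mat A1 A2 T d *v column 1 B1) $ 1 \<noteq> 0 \<longrightarrow>
            (saddle_node_boundary A1 B1 A2 B2 C u h T d x0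
             \<longleftrightarrow> v_s = (deriv h d - (C ** Lambda_mat A1 A2 T d *v column 2 B1) $ 1 * v_r)
                        / (C ** Lambda_mat A1 A2 T d *v column 1 B1) $ 1))"
proof -
  define L where "L = Lambda_mat A1 A2 T d"
  define N where "N = matrix_inv (mat 1 - mexp (- ((T - d) *\<^sub>R A2)) ** mexp (- (d *\<^sub>R A1)))"
  have xd: "x0 d = X_mat A1 A2 T d *v (B1 *v u)"
    using periodic_solution_switching_state [OF d _ inv] x0 B by blast
  have "L *v (B1 *v u) = B1 *v u + (A1 - N ** (A1 - A2)) *v x0 d"
    by (simp add: L_def N_def Lambda_mat_def xd matrix_vector_mult_add_rdistrib matrix_vector_mul_assoc matrix_mul_assoc
        bounded_bilinear.add_left [OF bounded_bilinear_matrix_mult])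
  also have "\<dots> = A1 *v x0 d + B1 *v u - N *v ((A1 - A2) *v x0 d)"
    by (simp add: matrix_vector_mult_diff_rdistrib [of A1 "N ** (A1 - A2)"] matrix_vector_mul_assoc)
  \<comment> \<open>Equal input matrices make the term with \<open>B1 - B2\<close> vanish.\<close>
  finally have "(C *v (A1 *v x0 d + B1 *v u)) $ 1 - (C *v (N *v ((A1 - A2) *v x0 d + (B1 - B2) *v u))) $ 1
      = (C *v (L *v (B1 *v u))) $ 1"
    using B by (simp add: matrix_vector_mult_diff_distrib)
  then have bound: "saddle_node_boundary A1 B1 A2 B2 C u h T d x0 \<longleftrightarrow> (C ** L ** B1 *v u) $ 1 = deriv h d"
    by (simp add: saddle_node_boundary_def N_def matrix_vector_mul_assoc matrix_mul_assoc)
  have "B1 *v u = v_s *\<^sub>R column 1 B1 + v_r *\<^sub>R column 2 B1"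
    by (simp add: u matrix_mult_sum sum_2 scalar_mult_eq_scaleR)
  then have "C ** L ** B1 *v u = v_s *\<^sub>R (C ** L *v column 1 B1) + v_r *\<^sub>R (C ** L *v column 2 B1)"
    by (simp add: matrix_vector_mul_assoc [symmetric] matrix_vector_right_distrib matrix_vector_mult_scaleR)
  then have "(C ** L ** B1 *v u) $ 1 = v_s * (C ** L *v column 1 B1) $ 1 + v_r * (C ** L *v column 2 B1) $ 1"
    by simp
  then have "(C ** L ** B1 *v u) $ 1 = deriv h d
      \<longleftrightarrow> v_s = (deriv h d - (C ** L *v column 2 B1) $ 1 * v_r) / (C ** L *v column 1 B1) $ 1"
    if "(C ** L *v column 1 B1) $ 1 \<noteq> 0"
    using that by (auto simp: field_simps)
  with bound saddle_node_bifurcation_iff_boundary [OF d h_diff x0 inv] show ?thesis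
    unfolding L_def by blast
qed

end
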